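(* Every (nondegenerate) triangle in the Euclidean plane is a $3$-periodic trajectory of the billiard within an ellipse. That is, for every triangle $KLM$ there is an ellipse $\mathcal{E}$ such that $KLM$ is a $3$-periodic billiard trajectory within $\mathcal{E}$. Moreover, that ellipse is uniquely determined by the triangle.
   Context: A billiard trajectory within an ellipse $\mathcal{E}$ is a polygonal line with all vertices on $\mathcal{E}$ such that any two consecutive sides satisfy the billiard reflection law at their common vertex: they form congruent angles with the tangent line to $\mathcal{E}$ at that vertex (equivalently, the tangent line is the bisector of the exterior angle formed by the two sides). A closed polygon with $n$ vertices is an $n$-periodic billiard trajectory within $\mathcal{E}$ if its vertices lie on $\mathcal{E}$ and the reflection law holds at each of its $n$ vertices. Circles are regarded as ellipses (with coinciding foci). *)

theory Defs
  imports "HOL-Analysis.Analysis"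
begin

type_synonym plane = "real^2"

text \<open>An ellipse is a curve (a set of points), given by its foci and the length of its major
  axis. The strict inequality excludes segments and points; coinciding foci give the circles.\<close>

definition is_ellipse :: "plane set \<Rightarrow> bool" where
  "is_ellipse E \<longleftrightarrow>
     (\<exists>F1 F2 a. dist F1 F2 < 2 * a \<and> E = {P. dist P F1 + dist P F2 = 2 * a})"

text \<open>The line through \<open>P\<close> spanned by the nonzero velocity at \<open>P\<close> of a motion along the curve
  \<open>E\<close>. The motion only has to be differentiable at time 0.\<close>

definition tangent_line_at :: "plane set \<Rightarrow> plane \<Rightarrow> plane set \<Rightarrow> bool" where
  "tangent_line_at E P L \<longleftrightarrow>
     (\<exists>\<gamma> v. (\<forall>t::real. \<gamma> t \<in> E) \<and> \<gamma> 0 = P \<and> (\<gamma> has_vector_derivative v) (at 0) \<and> v \<noteq> 0 \<and>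
        L = {P + s *\<^sub>R v | s. True})"

definition angle_at :: "plane \<Rightarrow> plane \<Rightarrow> plane \<Rightarrow> real" where
  "angle_at A P B = arccos (((A - P) \<bullet> (B - P)) / (norm (A - P) * norm (B - P)))"

text \<open>The sides \<open>PA\<close> and \<open>PB\<close> form congruent angles with the two opposite rays \<open>PX\<close> and \<open>PY\<close>
  of the tangent line. If \<open>A\<close>, \<open>P\<close>, \<open>B\<close> are not collinear, this says that the tangent line
  bisects the exterior angle at \<open>P\<close>.\<close>

definition reflection_law :: "plane set \<Rightarrow> plane \<Rightarrow> plane \<Rightarrow> plane \<Rightarrow> bool" where
  "reflection_law E A P B \<longleftrightarrow>
     (\<exists>L. tangent_line_at E P L \<and>
        (\<exists>X\<in>L. \<exists>Y\<in>L. P \<in> open_segment X Y \<and> angle_at A P X = angle_at B P Y))"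

text \<open>The closed polygon is given by the cyclic list of its vertices.\<close>

definition periodic_billiard_trajectory :: "plane set \<Rightarrow> nat \<Rightarrow> plane list \<Rightarrow> bool" where
  "periodic_billiard_trajectory E n vs \<longleftrightarrow>
     2 \<le> n \<and> length vs = n \<and>
     (\<forall>i<n. vs ! i \<in> E \<and>
            vs ! i \<noteq> vs ! (Suc i mod n) \<and>
            reflection_law E (vs ! ((i + n - 1) mod n)) (vs ! i) (vs ! (Suc i mod n)))"

end

(* An ellipse is a level set q(P - C) = k of a positive definite quadratic form q, with polar
   form B. The tangent at P is B(P - C)-orthogonal, and the tangents allowed by the reflection law
   are the exterior bisectors, so the law at P with neighbours Q, R reads
   B(P - C, (Q - P)/|Q - P|) = B(P - C, (R - P)/|R - P|). As P and Q lie on the same level set,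
   B(P - C, Q - P) = - q(Q - P)/2 is symmetric in P and Q. Hence KLM is a billiard trajectory
   iff B(P - C, Q - P) = - l |Q - P|/2 for one l > 0 and all vertices P, Q. This determines the
   level set (in barycentric coordinates it is a yz + b zx + c xy = 0, with a, b, c the side
   lengths), and since q(Q - P) = l |Q - P|, a solution exists because the Gram matrix of two
   sides prescribed in this way is positive definite by the triangle inequality. *)

theory Submission
  imports Defs
begin

section \<open>Ellipses as level sets of quadratic forms\<close>

text \<open>The two-focus equation of an ellipse takes this shape once the roots are cleared, with
  \<open>d\<close> along the focal axis. In the plane every positive definite form can be so
  written, \<open>m\<close> and \<open>m - d \<bullet> d\<close> being its eigenvalues.\<close>

definition qf :: "real \<Rightarrow> 'a::real_inner \<Rightarrow> 'a \<Rightarrow> 'a \<Rightarrow> real" where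
  "qf m d x y = m * (x \<bullet> y) - (x \<bullet> d) * (y \<bullet> d)"

lemma qf_commute: "qf m d x y = qf m d y x"
  by (simp add: qf_def inner_commute)

lemma qf_linear_simps:
  "qf m d (x + y) z = qf m d x z + qf m d y z"
  "qf m d (x - y) z = qf m d x z - qf m d y z"
  "qf m d (- x) z = - qf m d x z"
  "qf m d (r *\<^sub>R x) z = r * qf m d x z"
  "qf m d z (x + y) = qf m d z x + qf m d z y"
  "qf m d z (x - y) = qf m d z x - qf m d z y"
  "qf m d z (- x) = - qf m d z x"
  "qf m d z (r *\<^sub>R x) = r * qf m d z x"
  "qf m d 0 z = 0"
  "qf m d z 0 = 0"
  by (simp_all add: qf_def inner_simps algebra_simps)

lemma qf_pos:
  assumes "d \<bullet> d < m" "x \<noteq> 0"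
  shows "0 < qf m d x x"
proof -
  have "(x \<bullet> d) * (x \<bullet> d) \<le> (x \<bullet> x) * (d \<bullet> d)"
    using Cauchy_Schwarz_ineq[of x d] by (simp add: power2_eq_square)
  also have "\<dots> < m * (x \<bullet> x)"
    using assms by (simp add: mult.commute)
  finally show ?thesis by (simp add: qf_def)
qed

text \<open>Put \<open>x = P - C\<close> and \<open>e = (x \<bullet> c) / a\<close>. Both sides say
  that the distances to the foci \<open>C + c\<close> and \<open>C - c\<close> are
  \<open>a - e\<close> and \<open>a + e\<close>: their squares always differ by
  \<open>4 * a * e\<close>, so a sum \<open>2 * a\<close> forces the difference
  \<open>2 * e\<close>.\<close>

lemma sum_dist_iff_qf:
  fixes P C c :: "'a::real_inner"
  assumes "norm c < a"
  shows "dist P (C + c) + dist P (C - c) = 2 * a \<longleftrightarrow>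
    qf (a\<^sup>2) c (P - C) (P - C) = a\<^sup>2 * (a\<^sup>2 - c \<bullet> c)"
proof -
  define x where "x = P - C"
  define p where "p = norm (x - c)"
  define q where "q = norm (x + c)"
  define e where "e = (x \<bullet> c) / a"
  have a: "a > 0" using assms norm_ge_zero[of c] by linarith
  have ea: "x \<bullet> c = a * e" using a by (simp add: e_def)
  have p2: "p\<^sup>2 = x \<bullet> x - 2 * (a * e) + c \<bullet> c"
    unfolding p_def power2_norm_eq_inner using ea by (simp add: inner_simps inner_commute)
  have q2: "q\<^sup>2 = x \<bullet> x + 2 * (a * e) + c \<bullet> c"
    unfolding q_def power2_norm_eq_inner using ea by (simp add: inner_simps inner_commute)
  have nonneg: "p \<ge> 0" "q \<ge> 0" by (simp_all add: p_def q_def)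
  have "dist P (C + c) + dist P (C - c) = p + q"
    by (simp add: p_def q_def x_def dist_norm algebra_simps)
  moreover have "qf (a\<^sup>2) c x x = a\<^sup>2 * (a\<^sup>2 - c \<bullet> c) \<longleftrightarrow> x \<bullet> x + c \<bullet> c = a\<^sup>2 + e\<^sup>2"
  proof -
    have "qf (a\<^sup>2) c x x - a\<^sup>2 * (a\<^sup>2 - c \<bullet> c) = a\<^sup>2 * (x \<bullet> x + c \<bullet> c - (a\<^sup>2 + e\<^sup>2))"
      by (simp add: qf_def ea algebra_simps power2_eq_square)
    then show ?thesis using a by auto
  qed
  moreover have "p + q = 2 * a \<longleftrightarrow> x \<bullet> x + c \<bullet> c = a\<^sup>2 + e\<^sup>2"
  proof
    assume s: "p + q = 2 * a"
    have "(q - p) * (p + q) = q\<^sup>2 - p\<^sup>2" by (simp add: algebra_simps power2_eq_square)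
    then have "(q - p) * (2 * a) = 2 * e * (2 * a)" by (simp add: s p2 q2)
    then have "q - p = 2 * e" using a by simp
    then have "q = a + e" using s by simp
    then show "x \<bullet> x + c \<bullet> c = a\<^sup>2 + e\<^sup>2"
      using q2 by (simp add: algebra_simps power2_eq_square)
  next
    assume h: "x \<bullet> x + c \<bullet> c = a\<^sup>2 + e\<^sup>2"
    have cc: "c \<bullet> c < a\<^sup>2"
      using assms a by (metis norm_ge_zero power2_norm_eq_inner power_strict_mono zero_less_numeral)
    \<comment> \<open>The squares of \<open>p\<close> and \<open>q\<close> are those of
      \<open>a - e\<close> and \<open>a + e\<close>; to take roots, \<open>\<bar>e\<bar> < a\<close>
      is needed, which Cauchy-Schwarz yields.\<close>
    have "(a * e)\<^sup>2 \<le> (x \<bullet> x) * (c \<bullet> c)"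
      using Cauchy_Schwarz_ineq[of x c] ea by simp
    also have "x \<bullet> x = a\<^sup>2 + e\<^sup>2 - c \<bullet> c" using h by simp
    finally have "(a\<^sup>2 - c \<bullet> c) * e\<^sup>2 \<le> (a\<^sup>2 - c \<bullet> c) * (c \<bullet> c)"
      by (simp add: algebra_simps power2_eq_square)
    then have "e\<^sup>2 \<le> c \<bullet> c" using cc by simp
    then have "\<bar>e\<bar> < \<bar>a\<bar>"
      using cc a by (intro power2_less_imp_less[of "\<bar>e\<bar>"]) simp_all
    then have "a + e > 0" "a - e > 0" using a by linarith+
    moreover have "q\<^sup>2 = (a + e)\<^sup>2" "p\<^sup>2 = (a - e)\<^sup>2"
      using p2 q2 h by (simp_all add: algebra_simps power2_eq_square)
    ultimately have "q = a + e" "p = a - e"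
      using nonneg by (simp_all add: power2_eq_iff_nonneg)
    then show "p + q = 2 * a" by simp
  qed
  ultimately show ?thesis by (simp add: x_def)
qed

lemma is_ellipse_iff_qf:
  "is_ellipse E \<longleftrightarrow>
     (\<exists>C m d k. d \<bullet> d < m \<and> 0 < k \<and> E = {P. qf m d (P - C) (P - C) = k})"
proof
  assume "is_ellipse E"
  then obtain F1 F2 a where
    F: "dist F1 F2 < 2 * a" and E: "E = {P. dist P F1 + dist P F2 = 2 * a}"
    unfolding is_ellipse_def by blast
  define C where "C = (1/2) *\<^sub>R (F1 + F2)"
  define c where "c = (1/2) *\<^sub>R (F1 - F2)"
  have F1: "F1 = C + c" and F2: "F2 = C - c"
    by (simp_all add: C_def c_def algebra_simps flip: scaleR_add_left)
  have c: "norm c < a" using F by (simp add: c_def dist_norm)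
  then have a: "0 < a" using norm_ge_zero[of c] by linarith
  have "c \<bullet> c < a\<^sup>2"
    using c by (metis norm_ge_zero power2_norm_eq_inner power_strict_mono zero_less_numeral)
  moreover from this a have "0 < a\<^sup>2 * (a\<^sup>2 - c \<bullet> c)" by simp
  moreover have "E = {P. qf (a\<^sup>2) c (P - C) (P - C) = a\<^sup>2 * (a\<^sup>2 - c \<bullet> c)}"
    unfolding E F1 F2 using sum_dist_iff_qf[OF c] by simp
  ultimately show "\<exists>C m d k. d \<bullet> d < m \<and> 0 < k \<and> E = {P. qf m d (P - C) (P - C) = k}"
    by blast
next
  assume "\<exists>C m d k. d \<bullet> d < m \<and> 0 < k \<and> E = {P. qf m d (P - C) (P - C) = k}"
  then obtain C m d k where
    d: "d \<bullet> d < m" and k: "0 < k" and E: "E = {P. qf m d (P - C) (P - C) = k}"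
    by blast
  have m: "m > 0" using d inner_ge_zero[of d] by linarith
  \<comment> \<open>A form and its level may be scaled together. This factor makes the scaled level
    equal \<open>a\<^sup>2 * (a\<^sup>2 - c \<bullet> c)\<close> for
    \<open>a\<^sup>2 = l * m\<close> and \<open>c = sqrt l *\<^sub>R d\<close>, as the two-focus
    equation requires.\<close>
  define l where "l = k / (m * (m - d \<bullet> d))"
  have l: "l > 0" using d k m by (simp add: l_def)
  define a where "a = sqrt (l * m)"
  define c where "c = sqrt l *\<^sub>R d"
  have a2: "a\<^sup>2 = l * m" using l m by (simp add: a_def)
  have c2: "c \<bullet> c = l * (d \<bullet> d)" using l by (simp add: c_def)
  have c: "norm c < a"
    using l d by (simp add: norm_eq_sqrt_inner c2 a_def)
  have "qf (a\<^sup>2) c x y = l * qf m d x y" for x y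
  proof -
    have "qf (a\<^sup>2) c x y = l * m * (x \<bullet> y) - (sqrt l)\<^sup>2 * ((x \<bullet> d) * (y \<bullet> d))"
      unfolding qf_def a2 c_def inner_scaleR_right by (simp only: power2_eq_square mult_ac)
    then show ?thesis using l by (simp add: qf_def right_diff_distrib)
  qed
  moreover have "a\<^sup>2 * (a\<^sup>2 - c \<bullet> c) = l * k"
  proof -
    have "a\<^sup>2 * (a\<^sup>2 - c \<bullet> c) = l * (l * (m * (m - d \<bullet> d)))"
      unfolding a2 c2 by (simp add: algebra_simps)
    also have "l * (m * (m - d \<bullet> d)) = k" using d m by (simp add: l_def)
    finally show ?thesis .
  qed
  ultimately have "E = {P. dist P (C + c) + dist P (C - c) = 2 * a}"
    using l by (simp add: E sum_dist_iff_qf[OF c])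
  moreover have "dist (C + c) (C - c) < 2 * a"
  proof -
    have "C + c - (C - c) = 2 *\<^sub>R c" by (simp add: scaleR_2)
    then show ?thesis using c by (simp add: dist_norm)
  qed
  ultimately show "is_ellipse E" unfolding is_ellipse_def by blast
qed

section \<open>Tangent lines of a level set\<close>

text \<open>The form is constant along the motion, and by symmetry its derivative at time 0 is twice
  the polar form of position and velocity.\<close>

lemma velocity_on_quadric:
  assumes "\<And>t. qf m d (\<gamma> t - C) (\<gamma> t - C) = k"
    and "(\<gamma> has_vector_derivative v) (at 0)"
  shows "qf m d (\<gamma> 0 - C) v = 0"
proof -
  note g = assms(2)[unfolded has_vector_derivative_def]
  have "((\<lambda>t. qf m d (\<gamma> t - C) (\<gamma> t - C)) has_derivative
      (\<lambda>t. t * (2 * qf m d (\<gamma> 0 - C) v))) (at 0)"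
    unfolding qf_def
    by (auto intro!: derivative_eq_intros g simp: algebra_simps inner_commute)
  then have "((\<lambda>t::real. k) has_derivative (\<lambda>t. t * (2 * qf m d (\<gamma> 0 - C) v))) (at 0)"
    by (simp add: assms(1))
  then have "(\<lambda>t. t * (2 * qf m d (\<gamma> 0 - C) v)) = (\<lambda>t. 0)"
    by (rule has_derivative_unique) simp
  then show ?thesis by (metis mult_1 mult_eq_0_iff zero_neq_numeral)
qed

text \<open>Converse to \<open>velocity_on_quadric\<close>: a vector conjugate to
  \<open>P - C\<close> is the velocity of the affine image of a uniform circular motion, built from
  two conjugate semidiameters.\<close>

lemma tangent_line_at_quadric:
  fixes P C :: plane
  assumes "d \<bullet> d < m" "0 < k" "qf m d (P - C) (P - C) = k" "v \<noteq> 0" "qf m d (P - C) v = 0"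
  shows "tangent_line_at {P. qf m d (P - C) (P - C) = k} P {P + s *\<^sub>R v | s. True}"
proof -
  have "0 < qf m d v v" using assms qf_pos by blast
  \<comment> \<open>\<open>v / w\<close> is the semidiameter conjugate to \<open>P - C\<close>.\<close>
  define w where "w = sqrt (qf m d v v / k)"
  have w: "w > 0" "w\<^sup>2 = qf m d v v / k"
    using \<open>0 < qf m d v v\<close> assms by (simp_all add: w_def)
  define \<gamma> where "\<gamma> t = C + cos (w * t) *\<^sub>R (P - C) + (sin (w * t) / w) *\<^sub>R v" for t
  have "qf m d (\<gamma> t - C) (\<gamma> t - C) = k" for t
  proof -
    have "\<gamma> t - C = cos (w * t) *\<^sub>R (P - C) + (sin (w * t) / w) *\<^sub>R v"
      by (simp add: \<gamma>_def)
    moreover have "qf m d v (P - C) = 0" using assms(5) by (simp add: qf_commute)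
    ultimately have "qf m d (\<gamma> t - C) (\<gamma> t - C) =
        (cos (w * t))\<^sup>2 * k + (sin (w * t))\<^sup>2 * (qf m d v v / w\<^sup>2)"
      using assms(3,5)
      by (simp only: qf_linear_simps(1,4,5,8)) (simp add: power2_eq_square)
    also have "qf m d v v / w\<^sup>2 = k"
      using w \<open>0 < qf m d v v\<close> assms(2) by (simp add: w(2))
    finally show ?thesis
      by (metis distrib_right sin_cos_squared_add2 mult_1)
  qed
  moreover have "\<gamma> 0 = P" by (simp add: \<gamma>_def)
  moreover have "(\<gamma> has_vector_derivative v) (at 0)"
    unfolding \<gamma>_def using w by (auto intro!: derivative_eq_intros)
  ultimately show ?thesis
    using assms(4) unfolding tangent_line_at_def mem_Collect_eq
    by (intro exI[of _ \<gamma>] exI[of _ v] conjI allI refl)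
qed

section \<open>The reflection law in terms of the form\<close>

lemma angle_at_sgn: "angle_at A P B = arccos (sgn (A - P) \<bullet> sgn (B - P))"
  by (simp add: angle_at_def sgn_div_norm divide_inverse mult_ac)

text \<open>Places the arguments in the range where \<open>arccos\<close> is injective, so that
  congruent angles become equal inner products.\<close>

lemma abs_inner_sgn_le_1: "\<bar>sgn x \<bullet> sgn y\<bar> \<le> (1::real)"
  using Cauchy_Schwarz_ineq2[of "sgn x" "sgn y"]
  by (auto simp: norm_sgn split: if_splits)

lemma sgn_opposite_if_open_segment:
  fixes P X Y :: "'a::real_normed_vector"
  assumes "P \<in> open_segment X Y"
  shows "sgn (Y - P) = - sgn (X - P)"
proof -
  obtain u where u: "0 < u" "u < 1" "P = (1 - u) *\<^sub>R X + u *\<^sub>R Y"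
    using assms by (auto simp: in_segment)
  have X: "X - P = u *\<^sub>R (X - Y)" and Y: "Y - P = (1 - u) *\<^sub>R (- (X - Y))"
    by (simp_all add: u(3) algebra_simps)
  show ?thesis unfolding X Y sgn_scaleR sgn_minus using u(1,2) by simp
qed

lemma noncollinear_det:
  fixes K L M :: plane
  assumes "\<not> collinear {K, L, M}"
  shows "(L - K)$1 * (M - K)$2 - (L - K)$2 * (M - K)$1 \<noteq> 0"
proof
  assume *: "(L - K)$1 * (M - K)$2 - (L - K)$2 * (M - K)$1 = 0"
  define u where "u = L - K"
  define w where "w = M - K"
  have det: "u$1 * w$2 = u$2 * w$1" using * by (simp add: u_def w_def)
  have "collinear {0, u, w}"
  proof (cases "u = 0")
    case False
    then have uu: "u \<bullet> u \<noteq> 0" by simp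
    \<comment> \<open>In coordinates,
      \<open>(u \<bullet> u) *\<^sub>R w - (u \<bullet> w) *\<^sub>R u\<close> is the determinant
      times \<open>u\<close> turned by a right angle.\<close>
    have "(u \<bullet> u) *\<^sub>R w = (u \<bullet> w) *\<^sub>R u"
      using det unfolding vec_eq_iff forall_2 inner_vec_def sum_2
      by (simp add: algebra_simps)
    then have "w = ((u \<bullet> w) / (u \<bullet> u)) *\<^sub>R u"
      using uu by (metis scaleR_one divide_inverse_commute left_inverse scaleR_scaleR)
    then show ?thesis by (metis collinear_lemma)
  qed (simp add: collinear_lemma)
  then have "collinear {L, K, M}"
    using collinear_3[of L K M] by (simp add: u_def w_def)
  then show False using assms by (simp add: insert_commute)
qed

lemma noncollinear_span:
  fixes K L M :: plane
  assumes "\<not> collinear {K, L, M}"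
  obtains y z where "x = y *\<^sub>R (L - K) + z *\<^sub>R (M - K)"
proof
  define u where "u = L - K"
  define w where "w = M - K"
  define D where "D = u$1 * w$2 - u$2 * w$1"
  have "D \<noteq> 0" using noncollinear_det[OF assms] by (simp add: u_def w_def D_def)
  \<comment> \<open>Cramer's rule.\<close>
  then have "x = ((x$1 * w$2 - x$2 * w$1) / D) *\<^sub>R u + ((u$1 * x$2 - u$2 * x$1) / D) *\<^sub>R w"
    by (simp add: vec_eq_iff forall_2 add_divide_distrib[symmetric] eq_divide_eq)
       (simp add: D_def algebra_simps)
  then show "x = ((x$1 * (M - K)$2 - x$2 * (M - K)$1) / D) *\<^sub>R (L - K) +
      (((L - K)$1 * x$2 - (L - K)$2 * x$1) / D) *\<^sub>R (M - K)"
    by (simp add: u_def w_def)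
qed

text \<open>For the unit vectors \<open>a\<close>, \<open>b\<close> along the sides, the angle
  condition on a tangent direction \<open>v\<close> is \<open>v \<bullet> (a + b) = 0\<close>. In
  the plane this leaves only the multiples of \<open>a - b\<close>, and \<open>a - b\<close> is
  tangent iff the form pairs \<open>a\<close> and \<open>b\<close> equally with
  \<open>P - C\<close>.\<close>

lemma reflection_law_iff:
  fixes A P B C :: plane
  assumes dm: "d \<bullet> d < m" and k: "0 < k" and PE: "qf m d (P - C) (P - C) = k"
    and nc: "\<not> collinear {P, A, B}"
  shows "reflection_law {P. qf m d (P - C) (P - C) = k} A P B \<longleftrightarrow>
    qf m d (P - C) (sgn (A - P)) = qf m d (P - C) (sgn (B - P))"
    (is "reflection_law ?E A P B \<longleftrightarrow> ?eq")
proof -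
  define a where "a = sgn (A - P)"
  define b where "b = sgn (B - P)"
  have neq: "A \<noteq> P" "B \<noteq> P" using nc by (auto simp: insert_commute)
  have aa: "a \<bullet> a = 1" and bb: "b \<bullet> b = 1"
    using neq by (simp_all add: a_def b_def dot_square_norm norm_sgn)
  have AP: "A - P = norm (A - P) *\<^sub>R a" and BP: "B - P = norm (B - P) *\<^sub>R b"
    using neq by (simp_all add: a_def b_def sgn_div_norm)
  have dep: False if "b = r *\<^sub>R a" for r
  proof -
    have "B - P = (norm (B - P) * r / norm (A - P)) *\<^sub>R (A - P)"
      using neq by (subst BP) (simp add: that a_def sgn_div_norm divide_inverse)
    then have "collinear {0, A - P, B - P}" by (metis collinear_lemma)
    then have "collinear {A, P, B}" using collinear_3[of A P B] by simp
    then show False using nc by (simp add: insert_commute)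
  qed
  \<comment> \<open>This is the inner product of \<open>a + b\<close> with \<open>a\<close> and with
    \<open>b\<close>. As it is nonzero, \<open>v = y' *\<^sub>R a + z' *\<^sub>R b\<close> is
    orthogonal to \<open>a + b\<close> only if \<open>z' = - y'\<close>.\<close>
  have ab: "1 + a \<bullet> b \<noteq> 0"
  proof
    assume "1 + a \<bullet> b = 0"
    then have "(a + b) \<bullet> (a + b) = 0" by (simp add: inner_simps aa bb inner_commute)
    then have "b = (-1) *\<^sub>R a" by (simp add: add_eq_0_iff)
    then show False by (rule dep)
  qed
  show ?thesis
  proof
    assume "reflection_law ?E A P B"
    then obtain \<gamma> v X Y where
      \<gamma>: "\<And>t. \<gamma> t \<in> ?E" "\<gamma> 0 = P" "(\<gamma> has_vector_derivative v) (at 0)" and "v \<noteq> 0"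
      and X: "X \<in> {P + s *\<^sub>R v | s. True}" and XY: "P \<in> open_segment X Y"
      and ang: "angle_at A P X = angle_at B P Y"
      unfolding reflection_law_def tangent_line_at_def by blast
    have tangent: "qf m d (P - C) v = 0"
      using velocity_on_quadric[of m d \<gamma> C k v] \<gamma> by simp
    obtain s where "X = P + s *\<^sub>R v" using X by blast
    then have s: "X - P = s *\<^sub>R v" by simp
    have "X \<noteq> P" using XY by (auto simp: open_segment_def)
    then have "s \<noteq> 0" using s by auto
    \<comment> \<open>The rays to \<open>X\<close> and \<open>Y\<close> are opposite, so both angles
      can be expressed by the direction of \<open>X - P\<close>.\<close>
    have "a \<bullet> sgn (X - P) = - (b \<bullet> sgn (X - P))"
      using ang abs_inner_sgn_le_1 arccos_eq_iff
      unfolding angle_at_sgn sgn_opposite_if_open_segment[OF XY] a_def b_def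
      by (metis abs_minus_cancel inner_minus_right)
    then have "s * (a \<bullet> v) = s * (- (b \<bullet> v))"
      using \<open>s \<noteq> 0\<close> \<open>v \<noteq> 0\<close> by (simp add: s sgn_div_norm field_simps)
    then have "a \<bullet> v = - (b \<bullet> v)" using \<open>s \<noteq> 0\<close> by (simp only: mult_cancel_left) simp
    moreover obtain y z where "v = y *\<^sub>R (A - P) + z *\<^sub>R (B - P)"
      using noncollinear_span[OF nc] .
    then obtain y' z' where v: "v = y' *\<^sub>R a + z' *\<^sub>R b"
      using AP BP by (metis scaleR_scaleR)
    ultimately have "(y' + z') * (1 + a \<bullet> b) = 0"
      by (simp add: inner_simps aa bb inner_commute algebra_simps)
    then have z': "z' = - y'" using ab by simp
    then have "y' \<noteq> 0" using v \<open>v \<noteq> 0\<close> by auto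
    moreover have "y' * (qf m d (P - C) a - qf m d (P - C) b) = 0"
      using tangent unfolding v z' qf_linear_simps by (simp add: algebra_simps)
    ultimately show ?eq
      by (simp add: a_def b_def)
  next
    assume *: ?eq
    define v where "v = a - b"
    have "v \<noteq> 0" using dep[of 1] by (auto simp: v_def)
    have "qf m d (P - C) v = 0" using * by (simp add: v_def a_def b_def qf_linear_simps)
    then have tl: "tangent_line_at ?E P {P + s *\<^sub>R v | s. True}"
      using tangent_line_at_quadric[OF dm k PE \<open>v \<noteq> 0\<close>] by simp
    have "a \<bullet> v = - (b \<bullet> v)" by (simp add: v_def inner_simps aa bb inner_commute)
    then have "angle_at A P (P + 1 *\<^sub>R v) = angle_at B P (P + (-1) *\<^sub>R v)"
      by (simp add: angle_at_sgn sgn_minus) (simp add: a_def b_def sgn_div_norm)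
    moreover have "P \<in> open_segment (P + 1 *\<^sub>R v) (P + (-1) *\<^sub>R v)"
    proof -
      have "P = (1 - 1/2) *\<^sub>R (P + v) + (1/2) *\<^sub>R (P - v)"
        by (simp add: algebra_simps flip: scaleR_add_left)
      moreover have "P + v \<noteq> P - v"
      proof
        assume "P + v = P - v"
        then have "2 *\<^sub>R v = 0" by (simp add: scaleR_2 algebra_simps)
        then show False using \<open>v \<noteq> 0\<close> by simp
      qed
      ultimately show ?thesis
        unfolding in_segment by (intro conjI exI[of _ "1/2"]) simp_all
    qed
    ultimately show "reflection_law ?E A P B"
      unfolding reflection_law_def using tl by blast
  qed
qed

section \<open>Planar forms with a prescribed Gram matrix\<close>

lemma pos_def_form_eq_qf:
  fixes \<alpha> \<beta> \<gamma> :: real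
  assumes "0 < \<alpha>" "\<beta>\<^sup>2 < \<alpha> * \<gamma>"
  obtains m and d :: plane where "d \<bullet> d < m"
    "\<And>x y. qf m d x y = \<alpha> * (x$1 * y$1) + \<beta> * (x$1 * y$2 + x$2 * y$1) + \<gamma> * (x$2 * y$2)"
proof
  \<comment> \<open>\<open>m\<close> is the larger eigenvalue, so \<open>m (x \<bullet> x)\<close> minus the form is a square \<open>(x \<bullet> d)\<^sup>2\<close>.\<close>
  define D where "D = sqrt ((\<alpha> - \<gamma>)\<^sup>2 + 4 * \<beta>\<^sup>2)"
  define m where "m = (\<alpha> + \<gamma> + D) / 2"
  define d1 where "d1 = sqrt (m - \<alpha>)"
  \<comment> \<open>The mixed coefficient of \<open>qf m d\<close> is \<open>- (d1 * d2)\<close>;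
    the sign of \<open>d2\<close> is chosen to make it \<open>\<beta>\<close>.\<close>
  define d2 where "d2 = (if \<beta> \<le> 0 then sqrt (m - \<gamma>) else - sqrt (m - \<gamma>))"
  define d :: plane where "d = vector [d1, d2]"
  have "0 < \<alpha> * \<gamma>" using assms(2) zero_le_power2[of \<beta>] by linarith
  then have \<gamma>: "0 < \<gamma>" using assms(1) by (simp add: zero_less_mult_iff)
  have D2: "D\<^sup>2 = (\<alpha> - \<gamma>)\<^sup>2 + 4 * \<beta>\<^sup>2" by (simp add: D_def)
  have "\<bar>\<alpha> - \<gamma>\<bar> \<le> D" unfolding D_def by (rule real_le_rsqrt) simp
  then have le: "0 \<le> m - \<alpha>" "0 \<le> m - \<gamma>" by (simp_all add: m_def abs_le_iff field_simps)
  \<comment> \<open>Equivalently, the smaller eigenvalue \<open>m - d \<bullet> d\<close> is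
    positive.\<close>
  have "D < \<alpha> + \<gamma>"
    unfolding D_def
    by (rule real_less_lsqrt) (use assms \<gamma> in \<open>auto simp: power2_eq_square algebra_simps\<close>)
  have d1: "d1 * d1 = m - \<alpha>" and d2: "d2 * d2 = m - \<gamma>" using le by (simp_all add: d1_def d2_def)
  have "(m - \<alpha>) * (m - \<gamma>) = (D\<^sup>2 - (\<alpha> - \<gamma>)\<^sup>2) / 4"
    by (simp add: m_def power2_eq_square field_simps)
  then have "sqrt (m - \<alpha>) * sqrt (m - \<gamma>) = \<bar>\<beta>\<bar>"
    by (simp add: D2 flip: real_sqrt_mult)
  then have d12: "d1 * d2 = - \<beta>" by (simp add: d1_def d2_def)
  show "d \<bullet> d < m"
    using \<open>D < \<alpha> + \<gamma>\<close> by (simp add: d_def inner_vec_def sum_2 d1 d2) (simp add: m_def field_simps)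
  fix x y :: plane
  have "qf m d x y = (m - d1 * d1) * (x$1 * y$1) - (d1 * d2) * (x$1 * y$2 + x$2 * y$1)
      + (m - d2 * d2) * (x$2 * y$2)"
    by (simp add: qf_def d_def inner_vec_def sum_2 algebra_simps)
  then show "qf m d x y = \<alpha> * (x$1 * y$1) + \<beta> * (x$1 * y$2 + x$2 * y$1) + \<gamma> * (x$2 * y$2)"
    by (simp add: d1 d2 d12)
qed

lemma qf_with_given_gram:
  fixes u w :: plane
  assumes det: "u$1 * w$2 - u$2 * w$1 \<noteq> 0" and "0 < p" "r\<^sup>2 < p * s"
  obtains m d where "d \<bullet> d < m" "qf m d u u = p" "qf m d u w = r" "qf m d w w = s"
proof -
  define D where "D = u$1 * w$2 - u$2 * w$1"
  have D: "D \<noteq> 0" using det by (simp add: D_def)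
  \<comment> \<open>Let \<open>G\<close> be the Gram matrix with entries \<open>p\<close>,
    \<open>r\<close>, \<open>s\<close>, and \<open>T\<close> the matrix with columns
    \<open>u\<close>, \<open>w\<close> and determinant \<open>D\<close>. The form sought has matrix
    \<open>G\<close> transformed by the inverse of \<open>T\<close>; the primed numbers are its
    entries times \<open>D\<^sup>2\<close>, obtained with the adjugate of \<open>T\<close>.\<close>
  define \<alpha>' where "\<alpha>' = p * (w$2)\<^sup>2 - 2 * r * (w$2 * u$2) + s * (u$2)\<^sup>2"
  define \<beta>' where "\<beta>' = r * (w$2 * u$1 + w$1 * u$2) - p * (w$1 * w$2) - s * (u$1 * u$2)"
  define \<gamma>' where "\<gamma>' = p * (w$1)\<^sup>2 - 2 * r * (w$1 * u$1) + s * (u$1)\<^sup>2"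
  define \<alpha> \<beta> \<gamma> where "\<alpha> = \<alpha>' / D\<^sup>2" and "\<beta> = \<beta>' / D\<^sup>2" and "\<gamma> = \<gamma>' / D\<^sup>2"
  \<comment> \<open>Completing the square; the two squares cannot vanish together.\<close>
  have "p * \<alpha>' = (p * w$2 - r * u$2)\<^sup>2 + (p * s - r\<^sup>2) * (u$2)\<^sup>2"
    by (simp add: \<alpha>'_def power2_eq_square algebra_simps)
  also have "\<dots> > 0"
  proof (cases "u$2 = 0")
    case True
    then have "w$2 \<noteq> 0" using det by auto
    with True show ?thesis using \<open>0 < p\<close> by simp
  next
    case False
    then have "(p * s - r\<^sup>2) * (u$2)\<^sup>2 > 0" using assms(3) by simp
    then show ?thesis by (smt (verit) zero_le_power2)
  qed
  finally have "0 < \<alpha>'" using \<open>0 < p\<close> by (simp add: zero_less_mult_iff)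
  then have \<alpha>: "0 < \<alpha>" using D by (simp add: \<alpha>_def)
  \<comment> \<open>Multiplicativity of the determinant under this change of basis.\<close>
  have "\<alpha>' * \<gamma>' - \<beta>'\<^sup>2 = (p * s - r\<^sup>2) * D\<^sup>2"
    unfolding \<alpha>'_def \<beta>'_def \<gamma>'_def D_def by algebra
  moreover have "(p * s - r\<^sup>2) * D\<^sup>2 > 0" using assms(3) D by simp
  ultimately have "\<beta>'\<^sup>2 < \<alpha>' * \<gamma>'" by linarith
  then have "\<beta>\<^sup>2 < \<alpha> * \<gamma>"
    using D by (simp add: \<alpha>_def \<beta>_def \<gamma>_def power_divide divide_strict_right_mono flip: power2_eq_square)
  then obtain m and d :: plane where d: "d \<bullet> d < m" and
    q: "\<And>x y. qf m d x y = \<alpha> * (x$1 * y$1) + \<beta> * (x$1 * y$2 + x$2 * y$1) + \<gamma> * (x$2 * y$2)"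
    using pos_def_form_eq_qf \<alpha> by metis
  have q': "qf m d x y =
      (\<alpha>' * (x$1 * y$1) + \<beta>' * (x$1 * y$2 + x$2 * y$1) + \<gamma>' * (x$2 * y$2)) / D\<^sup>2" for x y
    by (simp add: q \<alpha>_def \<beta>_def \<gamma>_def add_divide_distrib)
  have "\<alpha>' * (u$1 * u$1) + \<beta>' * (u$1 * u$2 + u$2 * u$1) + \<gamma>' * (u$2 * u$2) = p * D\<^sup>2"
    "\<alpha>' * (u$1 * w$1) + \<beta>' * (u$1 * w$2 + u$2 * w$1) + \<gamma>' * (u$2 * w$2) = r * D\<^sup>2"
    "\<alpha>' * (w$1 * w$1) + \<beta>' * (w$1 * w$2 + w$2 * w$1) + \<gamma>' * (w$2 * w$2) = s * D\<^sup>2"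
    unfolding \<alpha>'_def \<beta>'_def \<gamma>'_def D_def by algebra+
  then have "qf m d u u = p" "qf m d u w = r" "qf m d w w = s"
    using D by (simp_all add: q')
  then show thesis using that d by blast
qed

text \<open>This is the positivity of the Gram determinant when the form is to take the value
  \<open>norm\<close> on \<open>u\<close>, \<open>w\<close> and \<open>w - u\<close>. The strict
  triangle inequalities place \<open>b + c - a\<close> above 0 and below both \<open>2 * b\<close>
  and \<open>2 * c\<close>.\<close>

lemma norm_triangle_discriminant:
  fixes u w :: plane
  assumes "u$1 * w$2 - u$2 * w$1 \<noteq> 0"
  shows "(norm w + norm u - norm (w - u))\<^sup>2 < 4 * norm w * norm u"
proof -
  define a b c where "a = norm (w - u)" and "b = norm w" and "c = norm u"
  define e where "e = u \<bullet> w"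
  have "u \<noteq> 0" "w \<noteq> 0" using assms by auto
  then have pos: "0 \<le> a" "0 < b" "0 < c" by (simp_all add: a_def b_def c_def)
  have a2: "a\<^sup>2 = b\<^sup>2 + c\<^sup>2 - 2 * e"
    unfolding a_def b_def c_def e_def power2_norm_eq_inner
    by (simp add: inner_simps inner_commute)
  \<comment> \<open>Lagrange's identity, which makes Cauchy-Schwarz strict for independent
    vectors.\<close>
  have "(b * c)\<^sup>2 - e\<^sup>2 = (u$1 * w$2 - u$2 * w$1)\<^sup>2"
    unfolding power_mult_distrib b_def c_def e_def power2_norm_eq_inner inner_vec_def sum_2 inner_real_def
    by algebra
  moreover have "0 < (u$1 * w$2 - u$2 * w$1)\<^sup>2" using assms by simp
  ultimately have "\<bar>e\<bar>\<^sup>2 < (b * c)\<^sup>2" unfolding power2_abs by linarith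
  then have e: "\<bar>e\<bar> < b * c" using pos by (intro power2_less_imp_less[of "\<bar>e\<bar>"]) simp_all
  have "a\<^sup>2 < (b + c)\<^sup>2" using a2 e by (simp add: power2_sum)
  then have 1: "a < b + c" using pos by (intro power2_less_imp_less[of a]) simp_all
  have "\<bar>b - c\<bar>\<^sup>2 < a\<^sup>2" using a2 e by (simp add: power2_diff)
  then have "\<bar>b - c\<bar> < a" using pos(1) by (rule power2_less_imp_less)
  then have "b + c - a < 2 * b" "b + c - a < 2 * c" by linarith+
  then have "(b + c - a) * (b + c - a) < (2 * b) * (2 * c)"
    using 1 pos by (intro mult_strict_mono) auto
  then show ?thesis by (simp add: a_def b_def c_def power2_eq_square)
qed

section \<open>Billiard triangles and their ellipse\<close>

text \<open>The law equates \<open>g\<close> along the two sides at each vertex, and a common level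
  makes \<open>g\<close> symmetric, so all six values agree. Calling the common value
  \<open>- l / 2\<close> gives the form the value \<open>l * norm (Q - P)\<close> on each
  side.\<close>

lemma billiard_triangle_iff:
  fixes K L M C :: plane
  assumes nc: "\<not> collinear {K, L, M}" and dm: "d \<bullet> d < m" and k: "0 < k"
  shows "periodic_billiard_trajectory {P. qf m d (P - C) (P - C) = k} 3 [K, L, M] \<longleftrightarrow>
    qf m d (K - C) (K - C) = k \<and>
    (\<exists>l>0. \<forall>P\<in>{K, L, M}. \<forall>Q\<in>{K, L, M}. qf m d (P - C) (Q - P) = - (l / 2) * norm (Q - P))"
    (is "periodic_billiard_trajectory ?E 3 _ \<longleftrightarrow> ?on \<and> (\<exists>l>0. ?chords l)")
proof -
  define g where "g P Q = qf m d (P - C) (sgn (Q - P))" for P Q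
  have g: "qf m d (P - C) (Q - P) = norm (Q - P) * g P Q" for P Q
    by (cases "P = Q") (simp_all add: g_def qf_linear_simps sgn_div_norm)
  have neq: "K \<noteq> L" "K \<noteq> M" "L \<noteq> M" using nc by (auto simp: insert_commute)
  \<comment> \<open>Used both ways: equal levels make the chord values symmetric, and symmetric
    chord values carry the level of \<open>K\<close> to \<open>L\<close> and
    \<open>M\<close>.\<close>
  have diff: "qf m d (Q - C) (Q - C) - qf m d (P - C) (P - C) =
      qf m d (P - C) (Q - P) - qf m d (Q - C) (P - Q)" for P Q
    by (simp add: qf_linear_simps qf_commute)
  have chord: "qf m d (Q - P) (Q - P) = - qf m d (P - C) (Q - P) - qf m d (Q - C) (P - Q)" for P Q
    by (simp add: qf_linear_simps)
  have nc': "\<not> collinear {K, M, L}" "\<not> collinear {L, K, M}" "\<not> collinear {M, L, K}"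
    using nc by (simp_all add: insert_commute)
  have "periodic_billiard_trajectory ?E 3 [K, L, M] \<longleftrightarrow>
      (K \<in> ?E \<and> L \<in> ?E \<and> M \<in> ?E) \<and>
      reflection_law ?E M K L \<and> reflection_law ?E K L M \<and> reflection_law ?E L M K"
  proof -
    have "(\<forall>i<3. R i) \<longleftrightarrow> R 0 \<and> R 1 \<and> R (2::nat)" for R
      by (auto simp: numeral_3_eq_3 numeral_2_eq_2 less_Suc_eq)
    then show ?thesis
      unfolding periodic_billiard_trajectory_def using neq by auto
  qed
  also have "\<dots> \<longleftrightarrow> (K \<in> ?E \<and> L \<in> ?E \<and> M \<in> ?E) \<and> g K M = g K L \<and> g L K = g L M \<and> g M L = g M K"
    using reflection_law_iff[OF dm k] nc' unfolding g_def mem_Collect_eq by blast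
  also have "\<dots> \<longleftrightarrow> ?on \<and> (\<exists>l>0. ?chords l)"
  proof (intro iffI conjI; (elim conjE exE)?)
    assume E: "K \<in> ?E" "L \<in> ?E" "M \<in> ?E" and G: "g K M = g K L" "g L K = g L M" "g M L = g M K"
    have sym: "g P Q = g Q P" if "P \<in> ?E" "Q \<in> ?E" "P \<noteq> Q" for P Q
      using diff[of Q P] that by (simp add: g norm_minus_commute)
    define l where "l = - 2 * g K L"
    have eqs: "g K L = - l / 2" "g L K = - l / 2" "g K M = - l / 2" "g M K = - l / 2"
        "g L M = - l / 2" "g M L = - l / 2"
      using sym E neq G by (auto simp: l_def)
    have "0 < qf m d (L - K) (L - K)" using dm neq by (intro qf_pos) auto
    then have "0 < l * norm (L - K)"
      unfolding chord[where P = K and Q = L] g by (simp add: eqs norm_minus_commute)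
    then have "0 < l" using neq by (simp add: zero_less_mult_iff)
    moreover have "?chords l"
      unfolding g by (auto simp: eqs)
    ultimately show "\<exists>l>0. ?chords l" by blast
  next
    fix l assume on: ?on and l: "0 < l" "?chords l"
    have "g P Q = - l / 2" if "P \<in> {K, L, M}" "Q \<in> {K, L, M}" "P \<noteq> Q" for P Q
      using l(2) that g[of P Q] by (metis (no_types, lifting) eq_iff_diff_eq_0 minus_divide_left mult.commute mult_cancel_left norm_eq_zero)
    then show "g K M = g K L" "g L K = g L M" "g M L = g M K" using neq by auto
    have "qf m d (P - C) (P - C) = k" if "P \<in> {K, L, M}" for P
      using diff[of P K] l(2) that on by (auto simp: norm_minus_commute)
    then show "K \<in> ?E" "L \<in> ?E" "M \<in> ?E" by auto
  qed auto
  finally show ?thesis .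
qed

text \<open>The right-hand side depends on the triangle alone, which gives uniqueness. In
  barycentric coordinates \<open>x = 1 - y - z\<close>, \<open>y\<close>, \<open>z\<close> its
  equation is the negative of a yz + b zx + c xy = 0.\<close>

lemma billiard_ellipse_eq:
  fixes K L M :: plane
  assumes nc: "\<not> collinear {K, L, M}"
    and E: "is_ellipse E" "periodic_billiard_trajectory E 3 [K, L, M]"
  shows "E = {K + y *\<^sub>R (L - K) + z *\<^sub>R (M - K) | y z.
    norm (L - K) * (y\<^sup>2 - y) + norm (M - K) * (z\<^sup>2 - z)
      + (norm (L - K) + norm (M - K) - norm (M - L)) * (y * z) = 0}"
    (is "_ = {_ | y z. ?F y z = 0}")
proof -
  obtain C m d k where dm: "d \<bullet> d < m" "0 < k" and E_eq: "E = {P. qf m d (P - C) (P - C) = k}"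
    using E(1)[unfolded is_ellipse_iff_qf] by (elim exE conjE) rule
  define u where "u = L - K"
  define w where "w = M - K"
  obtain l where on: "qf m d (K - C) (K - C) = k" and l: "0 < l" and
    chords: "\<forall>P\<in>{K, L, M}. \<forall>Q\<in>{K, L, M}. qf m d (P - C) (Q - P) = - (l / 2) * norm (Q - P)"
    using billiard_triangle_iff[OF nc dm] E(2) unfolding E_eq by blast
  have chord: "qf m d (Q - P) (Q - P) = l * norm (Q - P)"
    if "P \<in> {K, L, M}" "Q \<in> {K, L, M}" for P Q
  proof -
    have "qf m d (Q - P) (Q - P) = - qf m d (P - C) (Q - P) - qf m d (Q - C) (P - Q)"
      by (simp add: qf_linear_simps)
    also have "qf m d (P - C) (Q - P) = - (l / 2) * norm (Q - P)"
      using chords that by blast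
    also have "qf m d (Q - C) (P - Q) = - (l / 2) * norm (Q - P)"
      using chords that by (metis norm_minus_commute)
    finally show ?thesis by simp
  qed
  have uu: "qf m d u u = l * norm u" and ww: "qf m d w w = l * norm w"
    using chord by (simp_all add: u_def w_def)
  have wu: "w - u = M - L" by (simp add: u_def w_def)
  have "qf m d (w - u) (w - u) = l * norm (w - u)"
    using chord unfolding wu by simp
  then have uw: "2 * qf m d u w = l * (norm u + norm w - norm (w - u))"
    by (simp add: qf_linear_simps uu ww qf_commute[of m d w u] algebra_simps)
  have cu: "2 * qf m d (K - C) u = - l * norm u" and cw: "2 * qf m d (K - C) w = - l * norm w"
    using chords by (simp_all add: u_def w_def)
  \<comment> \<open>All coefficients carry the factor \<open>l\<close>, which therefore drops out of
    the equation of \<open>E\<close>; the constant term cancels because \<open>K\<close> lies on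
    \<open>E\<close>.\<close>
  have eq: "qf m d (K + y *\<^sub>R u + z *\<^sub>R w - C) (K + y *\<^sub>R u + z *\<^sub>R w - C) - k = l * ?F y z" for y z
  proof -
    define x where "x = K - C"
    have expand: "qf m d (x + y *\<^sub>R u + z *\<^sub>R w) (x + y *\<^sub>R u + z *\<^sub>R w) =
       qf m d x x + y * (2 * qf m d x u) + z * (2 * qf m d x w)
       + y\<^sup>2 * qf m d u u + z\<^sup>2 * qf m d w w + y * z * (2 * qf m d u w)"
      unfolding qf_linear_simps qf_commute[of m d u x] qf_commute[of m d w x] qf_commute[of m d w u]
      by (simp add: algebra_simps power2_eq_square)
    have shift: "K + y *\<^sub>R u + z *\<^sub>R w - C = x + y *\<^sub>R u + z *\<^sub>R w"
      by (simp add: x_def)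
    have "qf m d (K + y *\<^sub>R u + z *\<^sub>R w - C) (K + y *\<^sub>R u + z *\<^sub>R w - C) =
       k + y * (- l * norm u) + z * (- l * norm w)
       + y\<^sup>2 * (l * norm u) + z\<^sup>2 * (l * norm w) + y * z * (l * (norm u + norm w - norm (M - L)))"
      unfolding shift expand uu ww uw wu unfolding x_def on cu cw ..
    then show ?thesis
      unfolding u_def w_def by (simp only:) (simp add: algebra_simps)
  qed
  have "l \<noteq> 0" using l by simp
  have iff: "K + y *\<^sub>R u + z *\<^sub>R w \<in> E \<longleftrightarrow> ?F y z = 0" for y z
    unfolding E_eq mem_Collect_eq
    by (subst right_minus_eq[symmetric]) (simp only: eq mult_eq_0_iff \<open>l \<noteq> 0\<close> simp_thms)
  have rep: "\<exists>y z. P = K + y *\<^sub>R u + z *\<^sub>R w" for P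
  proof -
    obtain y z where "P - K = y *\<^sub>R (L - K) + z *\<^sub>R (M - K)"
      using noncollinear_span[OF nc] .
    then have "P = K + y *\<^sub>R u + z *\<^sub>R w"
      unfolding u_def w_def by (metis add.assoc add.commute diff_add_cancel)
    then show ?thesis by blast
  qed
  have "E = {K + y *\<^sub>R u + z *\<^sub>R w | y z. K + y *\<^sub>R u + z *\<^sub>R w \<in> E}"
  proof (intro equalityI subsetI)
    fix P assume "P \<in> E"
    with rep[of P] show "P \<in> {K + y *\<^sub>R u + z *\<^sub>R w | y z. K + y *\<^sub>R u + z *\<^sub>R w \<in> E}"
      by blast
  qed blast
  then show ?thesis unfolding iff unfolding u_def w_def .
qed

lemma billiard_ellipse_exists:
  fixes K L M :: plane
  assumes nc: "\<not> collinear {K, L, M}"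
  obtains E where "is_ellipse E" "periodic_billiard_trajectory E 3 [K, L, M]"
proof -
  define u where "u = L - K"
  define w where "w = M - K"
  have det: "u$1 * w$2 - u$2 * w$1 \<noteq> 0"
    using noncollinear_det[OF nc] by (simp add: u_def w_def)
  then have "u \<noteq> 0" by auto
  \<comment> \<open>The Gram matrix for \<open>l = 1\<close>, a choice of scale for the form. The
    entry \<open>r\<close> comes from polarizing the prescribed value \<open>norm (w - u)\<close> on
    \<open>w - u\<close>.\<close>
  define p s r where "p = norm u" and "s = norm w" and "r = (norm w + norm u - norm (w - u)) / 2"
  have p: "0 < p" using \<open>u \<noteq> 0\<close> by (simp add: p_def)
  have rps: "r\<^sup>2 < p * s"
    using norm_triangle_discriminant[OF det] by (simp add: r_def p_def s_def power_divide mult_ac)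
  obtain m d where dm: "d \<bullet> d < m" and
    q: "qf m d u u = p" "qf m d u w = r" "qf m d w w = s"
    using qf_with_given_gram[OF det p rps] .
  have q': "qf m d w u = r" using q(2) by (simp add: qf_commute)
  define D where "D = p * s - r\<^sup>2"
  have D: "D > 0" using rps by (simp add: D_def)
  \<comment> \<open>The vector from the centre to \<open>K\<close>, found by Cramer's rule from its
    required pairings \<open>- p / 2\<close> with \<open>u\<close> and \<open>- s / 2\<close> with
    \<open>w\<close>. The centre \<open>K - x\<close> is the Mittenpunkt, with barycentric
    coordinates a(b+c-a) : b(c+a-b) : c(a+b-c).\<close>
  define x where "x = ((r * s - p * s) / (2 * D)) *\<^sub>R u + ((r * p - p * s) / (2 * D)) *\<^sub>R w"
  have xu: "qf m d x u = - p / 2" and xw: "qf m d x w = - s / 2"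
  proof -
    have "((r * s - p * s) * p + (r * p - p * s) * r) = - p * D"
      "((r * s - p * s) * r + (r * p - p * s) * s) = - s * D"
      by (simp_all add: D_def algebra_simps power2_eq_square)
    moreover have "qf m d x u = ((r * s - p * s) * p + (r * p - p * s) * r) / (2 * D)"
      "qf m d x w = ((r * s - p * s) * r + (r * p - p * s) * s) / (2 * D)"
      unfolding x_def qf_linear_simps q q' by (simp_all add: add_divide_distrib)
    ultimately show "qf m d x u = - p / 2" "qf m d x w = - s / 2" using D by simp_all
  qed
  define C where "C = K - x"
  define k where "k = qf m d x x"
  have "x \<noteq> 0" using xu p by (auto simp: qf_linear_simps)
  then have k: "0 < k" using dm by (simp add: k_def qf_pos)
  have KC: "K - C = x" "L - C = x + u" "M - C = x + w"
    by (simp_all add: C_def u_def w_def)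
  have LK: "L - K = u" "K - L = - u" "M - K = w" "K - M = - w" "M - L = w - u" "L - M = - (w - u)"
    by (simp_all add: u_def w_def)
  \<comment> \<open>Only the two chords starting at \<open>K\<close> were imposed; the others follow
    since the form takes the value \<open>norm (Q - P)\<close> on each side.\<close>
  have "\<forall>P\<in>{K, L, M}. \<forall>Q\<in>{K, L, M}. qf m d (P - C) (Q - P) = - (1 / 2) * norm (Q - P)"
    unfolding ball_simps KC LK
    by (simp add: qf_linear_simps q q' xu xw norm_minus_commute[of u w])
       (simp add: p_def s_def r_def field_simps)
  then have "periodic_billiard_trajectory {P. qf m d (P - C) (P - C) = k} 3 [K, L, M]"
    unfolding billiard_triangle_iff[OF nc dm k] using KC(1) k_def
    by (intro conjI exI[of _ 1]) simp_all
  moreover have "is_ellipse {P. qf m d (P - C) (P - C) = k}"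
    unfolding is_ellipse_iff_qf using dm k by blast
  ultimately show thesis using that by blast
qed

theorem theorem5p1:
  fixes K L M :: plane
  assumes "\<not> collinear {K, L, M}"
  shows "\<exists>!E. is_ellipse E \<and> periodic_billiard_trajectory E 3 [K, L, M]"
proof -
  obtain E where "is_ellipse E" "periodic_billiard_trajectory E 3 [K, L, M]"
    using billiard_ellipse_exists[OF assms] .
  then show ?thesis
    using billiard_ellipse_eq[OF assms] by (intro ex1I[of _ E]) auto
qed

end
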